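(* For $u,v,n \in \mathbb{N}$, let $C_3(u,v,n)$ denote the number of partitions of $n$ into $u$ distinct parts congruent to $1$ modulo $3$ and $v$ distinct parts congruent to $2$ modulo $3$ (all parts distinct). Let $D_3(u,v,n)$ denote the number of overpartitions $\lambda_1 + \cdots + \lambda_s$ of $n$ such that only parts congruent to $\pm 1 \pmod 6$ can be overlined, $\overline{1}$ is not a part, $u$ equals the number of non-overlined parts congruent to $0$ or $1$ modulo $3$ plus twice the number of overlined parts congruent to $5$ modulo $6$, and $v$ equals the number of non-overlined parts congruent to $0$ or $2$ modulo $3$ plus twice the number of overlined parts congruent to $1$ modulo $6$, and satisfying, for all $1\le i<s$, $$\lambda_i - \lambda_{i+1} \geq \begin{cases} 4 + \chi(\overline{\lambda_{i+1}}) & \text{if } \lambda_{i} \equiv 1, 2, 3, 5 \pmod 6 \text{ and } \lambda_i \text{ is not overlined} , \\ 5 + \chi(\overline{\lambda_{i+1}}) & \text{if } \lambda_{i} \equiv 0, 4 \pmod 6, \\ 6 + \chi(\overline{\lambda_{i+1}}) & \text{if } \lambda_{i} \equiv 1, 5 \pmod 6 \text{ and } \lambda_i \text{ is overlined}, \end{cases}$$ where $\chi(\overline{\lambda_{i+1}})=1$ if $\lambda_{i+1}$ is overlined and $0$ otherwise. Then $C_3(u,v,n)=D_3(u,v,n)$ for all $u,v,n\in\mathbb{N}$.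
   Context: An overpartition of $n$ is a partition of $n$ (into positive integers, listed in non-increasing order) in which the first occurrence of each part value may be overlined; an overlined part $\overline{m}$ has value $m$. *)

theory Defs
  imports Main
begin

definition C3 :: "nat \<Rightarrow> nat \<Rightarrow> nat \<Rightarrow> nat" where
  "C3 u v n = card {S :: nat set. finite S \<and> (\<forall>x\<in>S. x mod 3 = 1 \<or> x mod 3 = 2)
      \<and> card {x\<in>S. x mod 3 = 1} = u \<and> card {x\<in>S. x mod 3 = 2} = v \<and> \<Sum>S = n}"

text \<open>An overpartition is represented as a list of pairs (value, overlined), listed in
  non-increasing order of values, all values positive, and only the first occurrence of a value
  may be overlined.\<close>
definition is_overpartition :: "(nat \<times> bool) list \<Rightarrow> nat \<Rightarrow> bool" where
  "is_overpartition xs n \<longleftrightarrow>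
     (\<forall>p\<in>set xs. fst p > 0)
     \<and> sorted_wrt (\<lambda>a b. fst b \<le> fst a) xs
     \<and> (\<forall>i<length xs. snd (xs ! i) \<longrightarrow> (i = 0 \<or> fst (xs ! (i - 1)) \<noteq> fst (xs ! i)))
     \<and> sum_list (map fst xs) = n"

definition gap3 :: "nat \<times> bool \<Rightarrow> nat \<times> bool \<Rightarrow> nat" where
  "gap3 a b = (let chi = (if snd b then 1 else 0) in
     if fst a mod 6 \<in> {0, 4} then 5 + chi
     else if snd a then 6 + chi
     else 4 + chi)"

definition D3_set :: "nat \<Rightarrow> nat \<Rightarrow> nat \<Rightarrow> (nat \<times> bool) list set" where
  "D3_set u v n = {xs. is_overpartition xs n
     \<and> (\<forall>p\<in>set xs. snd p \<longrightarrow> fst p mod 6 = 1 \<or> fst p mod 6 = 5)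
     \<and> (1, True) \<notin> set xs
     \<and> u = length (filter (\<lambda>p. \<not> snd p \<and> (fst p mod 3 = 0 \<or> fst p mod 3 = 1)) xs)
           + 2 * length (filter (\<lambda>p. snd p \<and> fst p mod 6 = 5) xs)
     \<and> v = length (filter (\<lambda>p. \<not> snd p \<and> (fst p mod 3 = 0 \<or> fst p mod 3 = 2)) xs)
           + 2 * length (filter (\<lambda>p. snd p \<and> fst p mod 6 = 1) xs)
     \<and> (\<forall>i. Suc i < length xs \<longrightarrow> fst (xs ! i) \<ge> fst (xs ! Suc i) + gap3 (xs ! i) (xs ! Suc i))}"

definition D3 :: "nat \<Rightarrow> nat \<Rightarrow> nat \<Rightarrow> nat" where
  "D3 u v n = card (D3_set u v n)"

end

theory Submission
  imports Defs "HOL-Computational_Algebra.Polynomial"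
begin

text \<open>
  Weight a non-overlined part \<open>m\<close> by \<open>A q^m\<close>, \<open>B q^m\<close> or \<open>A B q^m\<close> according to its residue 1, 2, 0
  modulo 3, and an overlined part by \<open>A^2 q^m\<close> or \<open>B^2 q^m\<close>.  Let \<open>F\<^sub>N(A, B)\<close> be the generating function
  of the overpartitions in question whose largest part \<open>\<lambda>\<close> satisfies \<open>\<lambda> + \<chi>(\<lambda>) \<le> N\<close>.  Removing the largest part
  gives linear recurrences for \<open>F\<^sub>N\<close>, and comparing those of \<open>F\<^sub>N(A, B)\<close> with those of \<open>F\<^sub>N(Bq, Aq^2)\<close>
  yields \<open>F\<^bsub>6j+6\<^esub>(A, B) = (1 + Aq) F\<^bsub>6j+4\<^esub>(Bq, Aq^2)\<close> by induction on \<open>j\<close>.  Modulo a fixed power of \<open>q\<close> the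
  index is irrelevant once it is large, so iterating gives the product of all \<open>1 + Aq^(3k+1)\<close> and
  \<open>1 + Bq^(3k+2)\<close>, which generates the partitions counted by \<open>C\<^sub>3\<close>.
\<close>

section \<open>Admissible lists and removal of the largest part\<close>

definition chi3 :: "nat \<times> bool \<Rightarrow> nat" where
  "chi3 p = (if snd p then 1 else 0)"

definition base_gap :: "nat \<times> bool \<Rightarrow> nat" where
  "base_gap p = (if fst p mod 6 \<in> {0, 4} then 5 else if snd p then 6 else 4)"

text \<open>Splitting the gap into a term of \<open>a\<close> and a term of \<open>b\<close> turns
  the gap condition into a bound on \<open>fst b + chi3 b\<close> that depends only on
  \<open>a\<close>.\<close>

lemma gap3_eq: "gap3 a b = base_gap a + chi3 b"
  by (simp add: gap3_def base_gap_def chi3_def)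

definition legal_part :: "nat \<times> bool \<Rightarrow> bool" where
  "legal_part p \<longleftrightarrow> fst p > 0 \<and> (snd p \<longrightarrow> fst p mod 6 = 1 \<or> fst p mod 6 = 5) \<and> p \<noteq> (1, True)"

definition admissible :: "(nat \<times> bool) list \<Rightarrow> bool" where
  "admissible xs \<longleftrightarrow> (\<forall>p\<in>set xs. legal_part p) \<and> successively (\<lambda>p r. fst r + gap3 p r \<le> fst p) xs"

text \<open>
  Bounding \<open>\<lambda> + \<chi>(\<lambda>)\<close> instead of \<open>\<lambda>\<close> makes the lists that may follow a given part again such an initial segment.
\<close>
definition bounded_adm :: "nat \<Rightarrow> (nat \<times> bool) list set" where
  "bounded_adm N = {xs. admissible xs \<and> (xs = [] \<or> fst (hd xs) + chi3 (hd xs) \<le> N)}"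

lemma admissible_Cons_iff:
  "admissible (p # xs) \<longleftrightarrow> legal_part p \<and> xs \<in> bounded_adm (fst p - base_gap p)"
proof (cases xs)
  case Nil
  then show ?thesis by (simp add: admissible_def bounded_adm_def)
next
  case (Cons r ys)
  \<comment> \<open>Truncated subtraction does no harm: if it gives 0, both sides are false because
    a legal \<open>r\<close> has positive value.\<close>
  have "fst r + gap3 p r \<le> fst p \<longleftrightarrow> fst r + chi3 r \<le> fst p - base_gap p" if "legal_part r"
    using that by (auto simp: legal_part_def gap3_eq)
  then show ?thesis
    unfolding Cons admissible_def bounded_adm_def by auto
qed

definition legal_parts_at :: "nat \<Rightarrow> (nat \<times> bool) set" where
  "legal_parts_at N = {p. legal_part p \<and> fst p + chi3 p = N}"

lemma bounded_adm_0: "bounded_adm 0 = {[]}"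
proof -
  have "fst (hd xs) > 0" if "admissible xs" "xs \<noteq> []" for xs
    using that by (cases xs) (auto simp: admissible_def legal_part_def)
  moreover have "admissible []" by (simp add: admissible_def)
  ultimately show ?thesis by (fastforce simp: bounded_adm_def)
qed

text \<open>A list under the bound \<open>N\<close> either stays under \<open>N - 1\<close> or
  attains \<open>N\<close> at its head; in the second case the tail is governed by the gap below
  that head.\<close>

lemma bounded_adm_step:
  assumes "N > 0"
  shows "bounded_adm N = bounded_adm (N - 1) \<union>
    (\<Union>p\<in>legal_parts_at N. (#) p ` bounded_adm (fst p - base_gap p))" (is "?L = ?R")
proof (intro set_eqI)
  fix xs
  show "xs \<in> ?L \<longleftrightarrow> xs \<in> ?R"
  proof (cases xs)
    case Nil
    then show ?thesis by (auto simp: bounded_adm_def)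
  next
    case (Cons p ys)
    have mem: "p # ys \<in> bounded_adm M \<longleftrightarrow>
        legal_part p \<and> ys \<in> bounded_adm (fst p - base_gap p) \<and> fst p + chi3 p \<le> M" for M
      using admissible_Cons_iff[of p ys] by (auto simp: bounded_adm_def[of M])
    have "p # ys \<in> (\<Union>r\<in>legal_parts_at N. (#) r ` bounded_adm (fst r - base_gap r)) \<longleftrightarrow>
        p \<in> legal_parts_at N \<and> ys \<in> bounded_adm (fst p - base_gap p)"
      by blast
    moreover have "fst p + chi3 p \<le> N \<longleftrightarrow> fst p + chi3 p \<le> N - 1 \<or> fst p + chi3 p = N"
      using assms by linarith
    ultimately show ?thesis
      unfolding Cons Un_iff mem[of N] mem[of "N - 1"] legal_parts_at_def mem_Collect_eq by blast
  qed
qed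

text \<open>An overlined part \<open>m\<close> is counted at \<open>N = m + 1\<close>, so the
  residues 1 and 5 modulo 6 appear as 2 and 0. The exception \<open>N = 2\<close> is the forbidden
  overlined 1.\<close>

lemma legal_parts_at_eq:
  assumes "N > 0"
  shows "legal_parts_at N = insert (N, False)
    (if N mod 6 \<in> {0, 2} \<and> N \<noteq> 2 then {(N - 1, True)} else {})"
proof -
  have T: "legal_part (m, True) \<longleftrightarrow> Suc m mod 6 \<in> {0, 2} \<and> Suc m \<noteq> 2" for m
    unfolding legal_part_def fst_conv snd_conv prod.inject insert_iff empty_iff simp_thms by presburger
  have F: "legal_part (m, False) \<longleftrightarrow> 0 < m" for m
    by (simp add: legal_part_def)
  have "(m, b) \<in> legal_parts_at N \<longleftrightarrow> (m, b) \<in> insert (N, False)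
    (if N mod 6 \<in> {0, 2} \<and> N \<noteq> 2 then {(N - 1, True)} else {})" for m b
  proof (cases b)
    case True
    have "m + 1 = N \<longleftrightarrow> m = N - 1" using assms by linarith
    with assms True show ?thesis
      by (auto simp: legal_parts_at_def chi3_def T)
  next
    case False
    with assms show ?thesis
      by (auto simp: legal_parts_at_def chi3_def F)
  qed
  then show ?thesis by auto
qed

lemma finite_bounded_adm [simp]: "finite (bounded_adm N)"
proof (induction N rule: less_induct)
  case (less N)
  show ?case
  proof (cases "N = 0")
    case True
    then show ?thesis by (simp add: bounded_adm_0)
  next
    case False
    have "fst p - base_gap p < N" if "p \<in> legal_parts_at N" for p
      using that False by (auto simp: legal_parts_at_def legal_part_def base_gap_def)
    moreover have "finite (legal_parts_at N)"
      using False by (simp add: legal_parts_at_eq)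
    ultimately show ?thesis
      using less False by (subst bounded_adm_step) auto
  qed
qed

section \<open>Generating function and its recurrences\<close>

definition part_weight :: "'a::comm_ring_1 \<Rightarrow> 'a \<Rightarrow> 'a \<Rightarrow> nat \<times> bool \<Rightarrow> 'a" where
  "part_weight A B q p = (if snd p then (if fst p mod 6 = 5 then A^2 else B^2)
     else if fst p mod 3 = 0 then A * B else if fst p mod 3 = 1 then A else B) * q ^ fst p"

text \<open>\<open>A\<close>, \<open>B\<close> and \<open>q\<close> are arbitrary ring elements, so
  that the substitution of \<open>B * q\<close> and \<open>A * q^2\<close> is just another
  instance.\<close>

definition adm_gf :: "'a::comm_ring_1 \<Rightarrow> 'a \<Rightarrow> 'a \<Rightarrow> nat \<Rightarrow> 'a" where
  "adm_gf A B q N = (\<Sum>xs\<in>bounded_adm N. prod_list (map (part_weight A B q) xs))"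

lemma adm_gf_0 [simp]: "adm_gf A B q 0 = 1"
  by (simp add: adm_gf_def bounded_adm_0)

lemma adm_gf_step:
  assumes "N > 0"
  shows "adm_gf A B q N = adm_gf A B q (N - 1) +
    (\<Sum>p\<in>legal_parts_at N. part_weight A B q p * adm_gf A B q (fst p - base_gap p))"
proof -
  let ?w = "\<lambda>xs. prod_list (map (part_weight A B q) xs)"
  let ?S = "\<lambda>p. (#) p ` bounded_adm (fst p - base_gap p)"
  have fin: "finite (legal_parts_at N)" using assms by (simp add: legal_parts_at_eq)
  have disj: "bounded_adm (N - 1) \<inter> (\<Union>p\<in>legal_parts_at N. ?S p) = {}"
    using assms by (auto simp: bounded_adm_def legal_parts_at_def)
  have "adm_gf A B q N = adm_gf A B q (N - 1) + sum ?w (\<Union>p\<in>legal_parts_at N. ?S p)"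
    unfolding adm_gf_def bounded_adm_step[OF assms]
    using fin disj by (subst sum.union_disjoint) auto
  also have "sum ?w (\<Union>p\<in>legal_parts_at N. ?S p) = (\<Sum>p\<in>legal_parts_at N. sum ?w (?S p))"
    using fin by (intro sum.UNION_disjoint) auto
  also have "\<dots> = (\<Sum>p\<in>legal_parts_at N. part_weight A B q p * adm_gf A B q (fst p - base_gap p))"
    by (simp add: sum.reindex adm_gf_def sum_distrib_left)
  finally show ?thesis .
qed

text \<open>The index \<open>N - 7\<close> belongs to an overlined part of value
  \<open>N - 1\<close>, whose base gap is 6.\<close>

lemma adm_gf_step_residues:
  fixes A B q :: "'a::comm_ring_1"
  assumes "N > 0"
  shows "adm_gf A B q N = adm_gf A B q (N - 1) +
    (if N mod 3 = 0 then A * B else if N mod 3 = 1 then A else B) * q^N *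
      adm_gf A B q (N - (if N mod 6 \<in> {0, 4} then 5 else 4)) +
    (if N mod 6 = 0 then A^2 * q^(N - 1) * adm_gf A B q (N - 7)
     else if N mod 6 = 2 \<and> N \<noteq> 2 then B^2 * q^(N - 1) * adm_gf A B q (N - 7) else 0)"
proof -
  obtain M where M: "N = Suc M" using assms by (cases N) auto
  have "Suc M mod 6 = 2 \<longleftrightarrow> M mod 6 = 1" "Suc M mod 6 = 0 \<longleftrightarrow> M mod 6 = 5" by presburger+
  then show ?thesis
    by (subst adm_gf_step[OF assms], subst legal_parts_at_eq[OF assms])
       (auto simp: M part_weight_def base_gap_def algebra_simps)
qed

text \<open>One recurrence for each residue modulo 6. At \<open>j = 0\<close> a truncated index 0
  stands for the empty tail only, and the case distinction removes the overlined 1.\<close>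

lemma adm_gf_rec:
  fixes A B q :: "'a::comm_ring_1"
  shows "adm_gf A B q (6*j+1) = adm_gf A B q (6*j) + A * q^(6*j+1) * adm_gf A B q (6*j-3)"
    and "adm_gf A B q (6*j+2) = adm_gf A B q (6*j+1) + B * q^(6*j+2) * adm_gf A B q (6*j-2)
           + (if j = 0 then 0 else B^2 * q^(6*j+1) * adm_gf A B q (6*j-5))"
    and "adm_gf A B q (6*j+3) = adm_gf A B q (6*j+2) + A * B * q^(6*j+3) * adm_gf A B q (6*j-1)"
    and "adm_gf A B q (6*j+4) = adm_gf A B q (6*j+3) + A * q^(6*j+4) * adm_gf A B q (6*j-1)"
    and "adm_gf A B q (6*j+5) = adm_gf A B q (6*j+4) + B * q^(6*j+5) * adm_gf A B q (6*j+1)"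
    and "adm_gf A B q (6*j+6) = adm_gf A B q (6*j+5) + A * B * q^(6*j+6) * adm_gf A B q (6*j+1)
           + A^2 * q^(6*j+5) * adm_gf A B q (6*j-1)"
proof -
  have m3: "(6*j+c) mod 3 = c mod 3" for c :: nat by presburger
  have m6: "(6*j+c) mod 6 = c mod 6" for c :: nat by presburger
  note r1 = adm_gf_step_residues[of "6*j+1" A B q, unfolded m3 m6]
  note r2 = adm_gf_step_residues[of "6*j+2" A B q, unfolded m3 m6]
  note r3 = adm_gf_step_residues[of "6*j+3" A B q, unfolded m3 m6]
  note r4 = adm_gf_step_residues[of "6*j+4" A B q, unfolded m3 m6]
  note r5 = adm_gf_step_residues[of "6*j+5" A B q, unfolded m3 m6]
  note r6 = adm_gf_step_residues[of "6*j+6" A B q, unfolded m3 m6]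
  show "adm_gf A B q (6*j+1) = adm_gf A B q (6*j) + A * q^(6*j+1) * adm_gf A B q (6*j-3)"
    using r1 by (simp add: add.commute)
  show "adm_gf A B q (6*j+2) = adm_gf A B q (6*j+1) + B * q^(6*j+2) * adm_gf A B q (6*j-2)
           + (if j = 0 then 0 else B^2 * q^(6*j+1) * adm_gf A B q (6*j-5))"
    using r2 by (simp add: add.commute)
  show "adm_gf A B q (6*j+3) = adm_gf A B q (6*j+2) + A * B * q^(6*j+3) * adm_gf A B q (6*j-1)"
    using r3 by (simp add: add.commute)
  show "adm_gf A B q (6*j+4) = adm_gf A B q (6*j+3) + A * q^(6*j+4) * adm_gf A B q (6*j-1)"
    using r4 by (simp add: add.commute)
  show "adm_gf A B q (6*j+5) = adm_gf A B q (6*j+4) + B * q^(6*j+5) * adm_gf A B q (6*j+1)"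
    using r5 by (simp add: add.commute)
  show "adm_gf A B q (6*j+6) = adm_gf A B q (6*j+5) + A * B * q^(6*j+6) * adm_gf A B q (6*j+1)
           + A^2 * q^(6*j+5) * adm_gf A B q (6*j-1)"
    using r6 by (simp add: add.commute)
qed

section \<open>The shift identity\<close>

text \<open>
  The induction step from \<open>j\<close> to \<open>j + 1\<close> of the next lemma as a pure ring identity: \<open>f\<^sub>k\<close> and \<open>g\<^sub>k\<close> stand for
  \<open>F\<^bsub>6j+k\<^esub>(A, B)\<close> and \<open>F\<^bsub>6j+k\<^esub>(Bq, Aq^2)\<close>, \<open>fm\<close> and \<open>gm\<close> for those with \<open>k = -1\<close>, and \<open>x\<close> for \<open>q^(6j)\<close>.
\<close>
lemma adm_gf_shift_step:
  fixes A B q x :: "'a::comm_ring_1"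
  assumes "f1 = (1 + A*q) * gm" "f3 = (1 + A*q) * g1" "f5 = g4 + A*q * g1" "f6 = (1 + A*q) * g4"
    and "g2 = g1 + A * q^4 * x * fm"
    and "f4 = f3 + A * q^4 * x * fm"
    and "g3 = g2 + A * B * q^6 * x * gm"
    and "g4 = g3 + B * q^5 * x * gm"
    and "g5 = g4 + A * q^7 * x * g1"
    and "g6 = g5 + A * B * q^9 * x * g1 + B^2 * q^7 * x * gm"
    and "f7 = f6 + A * q^7 * x * f3"
    and "f8 = f7 + B * q^8 * x * f4 + B^2 * q^7 * x * f1"
    and "f9 = f8 + A * B * q^9 * x * f5"
    and "f10 = f9 + A * q^10 * x * f5"
    and "f11 = f10 + B * q^11 * x * f7"
    and "f12 = f11 + A * B * q^12 * x * f7 + A^2 * q^11 * x * f5"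
    and "g7 = g6 + B * q^8 * x * g3"
    and "g8 = g7 + A * q^10 * x * g4 + A^2 * q^11 * x * g1"
    and "g9 = g8 + A * B * q^12 * x * g5"
    and "g10 = g9 + B * q^11 * x * g5"
  shows "f7 = (1 + A*q) * g5" "f9 = (1 + A*q) * g7" "f11 = g10 + A*q * g7"
    "f12 = (1 + A*q) * g10" "g8 = g7 + A * q^10 * x * f5"
proof -
  \<comment> \<open>The term with \<open>fm\<close> has the same coefficient in \<open>g2\<close>
    and in \<open>f4\<close>, so it can be eliminated.\<close>
  have f4: "f4 = (1 + A*q) * g1 + (g2 - g1)"
    using assms(2,5,6) by simp
  show f7: "f7 = (1 + A*q) * g5"
    unfolding assms(9,11) assms(2,4) by (simp add: algebra_simps power_numeral_reduce)
  show f9: "f9 = (1 + A*q) * g7"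
    unfolding assms(13) assms(12) f7 f4 assms(1,3) assms(17) assms(10) assms(9) assms(8) assms(7)
    by (simp add: algebra_simps power_numeral_reduce)
  show g8: "g8 = g7 + A * q^10 * x * f5"
    unfolding assms(18) assms(3) by (simp add: algebra_simps power_numeral_reduce)
  show f11: "f11 = g10 + A*q * g7"
    unfolding assms(15,14) f7 f9 assms(20,19) g8 by (simp add: algebra_simps power_numeral_reduce)
  show "f12 = (1 + A*q) * g10"
    unfolding assms(16) f11 f7 assms(20,19) g8 assms(3)
    by (simp add: algebra_simps power_numeral_reduce)
qed

text \<open>
  The last conjunct replaces the identity for \<open>F\<^bsub>6j-1\<^esub>\<close> obtained by shifting the third one, which
  fails at \<open>j = 0\<close> because of truncated subtraction.
\<close>
lemma adm_gf_shift_all: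
  fixes A B q :: "'a::comm_ring_1"
  defines "F \<equiv> adm_gf A B q" and "G \<equiv> adm_gf (B * q) (A * q^2) q"
  shows "F (6*j+1) = (1 + A*q) * G (6*j-1) \<and> F (6*j+3) = (1 + A*q) * G (6*j+1) \<and>
    F (6*j+5) = G (6*j+4) + A*q * G (6*j+1) \<and> F (6*j+6) = (1 + A*q) * G (6*j+4) \<and>
    G (6*j+2) = G (6*j+1) + A * q^4 * q^(6*j) * F (6*j-1)"
proof (induction j)
  case 0
  note F = adm_gf_rec[of A B q 0, folded F_def, simplified]
    and G = adm_gf_rec[of "B*q" "A*q^2" q 0, folded G_def, simplified]
  have "F 0 = 1" "G 0 = 1" by (simp_all add: F_def G_def)
  then show ?case
    by (simp add: F G algebra_simps power_numeral_reduce)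
next
  case (Suc j)
  define x where "x = q ^ (6*j)"
  have pw: "q ^ (6*j+k) = x * q^k" for k
    by (simp add: x_def power_add)
  have F0: "F (6*j+4) = F (6*j+3) + A * q^4 * x * F (6*j-1)"
    using adm_gf_rec(4)[of A B q j, folded F_def, unfolded pw] by (simp add: mult_ac)
  \<comment> \<open>In the recurrences for \<open>G\<close> the substitution raises the exponent of
    \<open>q\<close> by 1 for each \<open>B\<close> and by 2 for each \<open>A\<close>.\<close>
  have G0a: "G (6*j+3) = G (6*j+2) + A * B * q^6 * x * G (6*j-1)"
    using adm_gf_rec(3)[of "B*q" "A*q^2" q j, folded G_def, unfolded pw]
    by (simp add: algebra_simps power_numeral_reduce)
  have G0b: "G (6*j+4) = G (6*j+3) + B * q^5 * x * G (6*j-1)"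
    using adm_gf_rec(4)[of "B*q" "A*q^2" q j, folded G_def, unfolded pw]
    by (simp add: algebra_simps power_numeral_reduce)
  have G0c: "G (6*j+5) = G (6*j+4) + A * q^7 * x * G (6*j+1)"
    using adm_gf_rec(5)[of "B*q" "A*q^2" q j, folded G_def, unfolded pw]
    by (simp add: algebra_simps power_numeral_reduce)
  have G0d: "G (6*j+6) = G (6*j+5) + A * B * q^9 * x * G (6*j+1) + B^2 * q^7 * x * G (6*j-1)"
    using adm_gf_rec(6)[of "B*q" "A*q^2" q j, folded G_def, unfolded pw]
    by (simp add: algebra_simps power_numeral_reduce)
  have idx: "6 * Suc j = 6*j+6" "6*j+6+1 = 6*j+7" "6*j+6+2 = 6*j+8" "6*j+6+3 = 6*j+9"
    "6*j+6+4 = 6*j+10" "6*j+6+5 = 6*j+11" "6*j+6+6 = 6*j+12"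
    "6*j+6-1 = 6*j+5" "6*j+6-2 = 6*j+4" "6*j+6-3 = 6*j+3" "6*j+6-5 = 6*j+1"
    by simp_all
  have ne: "(Suc j = 0) = False" by simp
  have F1a: "F (6*j+7) = F (6*j+6) + A * q^7 * x * F (6*j+3)"
    using adm_gf_rec(1)[of A B q "Suc j", folded F_def, unfolded idx ne if_False pw]
    by (simp add: mult_ac)
  have F1b: "F (6*j+8) = F (6*j+7) + B * q^8 * x * F (6*j+4) + B^2 * q^7 * x * F (6*j+1)"
    using adm_gf_rec(2)[of A B q "Suc j", folded F_def, unfolded idx ne if_False pw]
    by (simp add: mult_ac)
  have F1c: "F (6*j+9) = F (6*j+8) + A * B * q^9 * x * F (6*j+5)"
    using adm_gf_rec(3)[of A B q "Suc j", folded F_def, unfolded idx ne if_False pw]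
    by (simp add: mult_ac)
  have F1d: "F (6*j+10) = F (6*j+9) + A * q^10 * x * F (6*j+5)"
    using adm_gf_rec(4)[of A B q "Suc j", folded F_def, unfolded idx ne if_False pw]
    by (simp add: mult_ac)
  have F1e: "F (6*j+11) = F (6*j+10) + B * q^11 * x * F (6*j+7)"
    using adm_gf_rec(5)[of A B q "Suc j", folded F_def, unfolded idx ne if_False pw]
    by (simp add: mult_ac)
  have F1f: "F (6*j+12) = F (6*j+11) + A * B * q^12 * x * F (6*j+7) + A^2 * q^11 * x * F (6*j+5)"
    using adm_gf_rec(6)[of A B q "Suc j", folded F_def, unfolded idx ne if_False pw]
    by (simp add: mult_ac)
  have G1a: "G (6*j+7) = G (6*j+6) + B * q^8 * x * G (6*j+3)"
    using adm_gf_rec(1)[of "B*q" "A*q^2" q "Suc j", folded G_def, unfolded idx ne if_False pw]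
    by (simp add: algebra_simps power_numeral_reduce)
  have G1b: "G (6*j+8) = G (6*j+7) + A * q^10 * x * G (6*j+4) + A^2 * q^11 * x * G (6*j+1)"
    using adm_gf_rec(2)[of "B*q" "A*q^2" q "Suc j", folded G_def, unfolded idx ne if_False pw]
    by (simp add: algebra_simps power_numeral_reduce)
  have G1c: "G (6*j+9) = G (6*j+8) + A * B * q^12 * x * G (6*j+5)"
    using adm_gf_rec(3)[of "B*q" "A*q^2" q "Suc j", folded G_def, unfolded idx ne if_False pw]
    by (simp add: algebra_simps power_numeral_reduce)
  have G1d: "G (6*j+10) = G (6*j+9) + B * q^11 * x * G (6*j+5)"
    using adm_gf_rec(4)[of "B*q" "A*q^2" q "Suc j", folded G_def, unfolded idx ne if_False pw]
    by (simp add: algebra_simps power_numeral_reduce)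
  from Suc.IH have IH: "F (6*j+1) = (1 + A*q) * G (6*j-1)" "F (6*j+3) = (1 + A*q) * G (6*j+1)"
    "F (6*j+5) = G (6*j+4) + A*q * G (6*j+1)" "F (6*j+6) = (1 + A*q) * G (6*j+4)"
    "G (6*j+2) = G (6*j+1) + A * q^4 * x * F (6*j-1)"
    by (simp_all only: x_def)
  note S = adm_gf_shift_step[OF IH F0 G0a G0b G0c G0d F1a F1b F1c F1d F1e F1f G1a G1b G1c G1d]
  have q10: "A * q^4 * (x * q^6) = A * q^10 * x"
    by (simp add: power_numeral_reduce mult_ac)
  show ?case
    unfolding idx pw q10 by (intro conjI S)
qed

lemma adm_gf_shift: "adm_gf A B q (6*j+6) = (1 + A*q) * adm_gf (B * q) (A * q^2) q (6*j+4)"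
  using adm_gf_shift_all[of A B q j] by blast

section \<open>Congruences modulo powers of \<open>q\<close> and iteration of the shift\<close>

text \<open>Every list that is new above the bound \<open>M\<close> has a head of value at least
  \<open>M\<close>. The exponent is not \<open>M + 1\<close>, since an overlined head of value
  \<open>M\<close> already exceeds the bound.\<close>

lemma adm_gf_stable:
  assumes "M < N"
  shows "q ^ M dvd adm_gf A B q N - adm_gf A B q M"
  using assms
proof (induction N)
  case (Suc N)
  have "q ^ M dvd part_weight A B q p" if "p \<in> legal_parts_at (Suc N)" for p
    using that Suc.prems
    by (auto simp: legal_parts_at_def chi3_def part_weight_def intro!: dvd_mult le_imp_power_dvd split: if_splits)
  then have "q ^ M dvd adm_gf A B q (Suc N) - adm_gf A B q N"
    by (subst adm_gf_step) (auto intro!: dvd_sum dvd_mult2)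
  moreover have "q ^ M dvd adm_gf A B q N - adm_gf A B q M"
    using Suc by (cases "M = N") auto
  ultimately show ?case
    using dvd_add by fastforce
qed simp

text \<open>Each part contributes a factor \<open>A\<close> or \<open>B\<close>, so only the empty
  list survives modulo \<open>d\<close>.\<close>

lemma dvd_adm_gf_minus_1:
  assumes "d dvd A" "d dvd B"
  shows "d dvd adm_gf A B q N - 1"
proof (induction N)
  case (Suc N)
  have "d dvd part_weight A B q p" for p
    using assms by (auto simp: part_weight_def power2_eq_square)
  then have "d dvd adm_gf A B q (Suc N) - adm_gf A B q N"
    by (subst adm_gf_step) (auto intro!: dvd_sum dvd_mult2)
  then show ?case
    using dvd_add[OF _ Suc] by fastforce
qed simp

text \<open>The exact identity relates the different indices \<open>6*j+6\<close> and
  \<open>6*j+4\<close>; modulo \<open>q ^ M\<close> both may be replaced by \<open>N\<close>. Taking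
  \<open>j = M\<close> makes them large enough.\<close>

lemma adm_gf_shift_mod:
  fixes A B q :: "'a::comm_ring_1"
  assumes "M < N"
  shows "q ^ M dvd adm_gf A B q N - (1 + A*q) * adm_gf (B * q) (A * q^2) q N"
proof -
  let ?F = "adm_gf A B q" and ?G = "adm_gf (B * q) (A * q^2) q"
  have F: "q ^ M dvd ?F N - ?F M" "q ^ M dvd ?F (6*M+6) - ?F M"
    and G: "q ^ M dvd ?G N - ?G M" "q ^ M dvd ?G (6*M+4) - ?G M"
    using assms by (simp_all add: adm_gf_stable)
  have "?F N - (1 + A*q) * ?G N =
      (?F N - ?F M) - (?F (6*M+6) - ?F M) + (1 + A*q) * ((?G (6*M+4) - ?G M) - (?G N - ?G M))"
    using adm_gf_shift[of A B q M] by (simp add: algebra_simps)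
  then show ?thesis
    using dvd_add[OF dvd_diff[OF F] dvd_mult[OF dvd_diff[OF G(2,1)]]] by (simp only:)
qed

text \<open>Two shifts restore the order of the variables: (A, B) becomes (Bq, Aq^2) and then (Aq^3,
  Bq^3), with the factors 1 + Aq and 1 + Bq^2.\<close>

lemma adm_gf_prod_mod:
  fixes A B q :: "'a::comm_ring_1"
  assumes "M < N"
  shows "q ^ M dvd adm_gf A B q N -
    (\<Prod>k<K. (1 + A * q^(3*k+1)) * (1 + B * q^(3*k+2))) * adm_gf (A * q^(3*K)) (B * q^(3*K)) q N"
proof (induction K)
  case (Suc K)
  define A' B' where "A' = A * q^(3*K)" and "B' = B * q^(3*K)"
  define P where "P = (\<Prod>k<K. (1 + A * q^(3*k+1)) * (1 + B * q^(3*k+2)))"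
  define F where "F = adm_gf A' B' q N"
  define G where "G = adm_gf (B' * q) (A' * q^2) q N"
  define H where "H = adm_gf (A' * q^3) (B' * q^3) q N"
  have "q ^ M dvd F - (1 + A'*q) * G"
    unfolding F_def G_def by (rule adm_gf_shift_mod[OF assms])
  moreover have "A' * q^2 * q = A' * q^3" "B' * q * q^2 = B' * q^3" "B' * q * q = B' * q^2"
    by (simp_all add: power_numeral_reduce mult_ac)
  then have "q ^ M dvd G - (1 + B'*q^2) * H"
    using adm_gf_shift_mod[OF assms, of q "B' * q" "A' * q^2"] by (simp add: G_def H_def)
  moreover have "q ^ M dvd adm_gf A B q N - P * F"
    using Suc by (simp add: P_def F_def A'_def B'_def)
  \<comment> \<open>The three differences, with these multipliers, telescope.\<close>
  ultimately have "q ^ M dvd (adm_gf A B q N - P * F) + P * (F - (1 + A'*q) * G)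
      + P * (1 + A'*q) * (G - (1 + B'*q^2) * H)"
    by (intro dvd_add dvd_mult)
  also have "(adm_gf A B q N - P * F) + P * (F - (1 + A'*q) * G)
      + P * (1 + A'*q) * (G - (1 + B'*q^2) * H)
      = adm_gf A B q N - P * (1 + A'*q) * (1 + B'*q^2) * H"
    by (simp add: algebra_simps)
  also have "H = adm_gf (A * q^(3*Suc K)) (B * q^(3*Suc K)) q N"
    by (simp add: H_def A'_def B'_def power_add mult_ac)
  also have "P * (1 + A'*q) * (1 + B'*q^2) = (\<Prod>k<Suc K. (1 + A * q^(3*k+1)) * (1 + B * q^(3*k+2)))"
    by (simp add: P_def A'_def B'_def power_add power2_eq_square mult_ac)
  finally show ?case .
qed simp

section \<open>The product over residues 1 and 2 modulo 3\<close>

definition nonmult3_below :: "nat \<Rightarrow> nat set" where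
  "nonmult3_below N = {x. x < N \<and> (x mod 3 = 1 \<or> x mod 3 = 2)}"

lemma finite_nonmult3_below [simp]: "finite (nonmult3_below N)"
  by (simp add: nonmult3_below_def)

lemma prod_nonmult3_below:
  fixes f :: "nat \<Rightarrow> 'a::comm_monoid_mult"
  shows "(\<Prod>k<K. f (3*k+1) * f (3*k+2)) = prod f (nonmult3_below (3*K))"
proof (induction K)
  case 0
  show ?case by (simp add: nonmult3_below_def)
next
  case (Suc K)
  have "(x < 3 * Suc K \<and> (x mod 3 = 1 \<or> x mod 3 = 2)) \<longleftrightarrow>
    x = 3*K+1 \<or> x = 3*K+2 \<or> (x < 3*K \<and> (x mod 3 = 1 \<or> x mod 3 = 2))" for x
    by presburger
  then have "nonmult3_below (3 * Suc K) = insert (3*K+1) (insert (3*K+2) (nonmult3_below (3*K)))"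
    unfolding nonmult3_below_def by blast
  moreover have "3*K+1 \<notin> nonmult3_below (3*K)" "3*K+2 \<notin> nonmult3_below (3*K)"
    by (simp_all add: nonmult3_below_def)
  ultimately show ?case
    using Suc by (simp add: mult_ac)
qed

text \<open>After \<open>M\<close> double shifts both variables are multiples of
  \<open>q ^ M\<close>, so the remaining generating function is congruent to 1.\<close>

lemma adm_gf_product:
  fixes A B q :: "'a::comm_ring_1"
  assumes "M < N"
  shows "q ^ M dvd adm_gf A B q N -
    (\<Prod>x\<in>nonmult3_below (3*M). 1 + (if x mod 3 = 1 then A else B) * q^x)"
proof -
  define P where "P = (\<Prod>k<M. (1 + A * q^(3*k+1)) * (1 + B * q^(3*k+2)))"
  have "(\<Prod>x\<in>nonmult3_below (3*M). 1 + (if x mod 3 = 1 then A else B) * q^x) =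
      (\<Prod>k<M. (1 + (if (3*k+1) mod 3 = 1 then A else B) * q^(3*k+1)) *
        (1 + (if (3*k+2) mod 3 = 1 then A else B) * q^(3*k+2)))"
    by (rule prod_nonmult3_below[symmetric])
  also have "\<dots> = P"
    unfolding P_def by (intro prod.cong refl arg_cong2[of _ _ _ _ "(*)"]) (simp_all add: mod_Suc)
  finally have P: "(\<Prod>x\<in>nonmult3_below (3*M). 1 + (if x mod 3 = 1 then A else B) * q^x) = P" .
  let ?R = "adm_gf (A * q^(3*M)) (B * q^(3*M)) q N"
  have d: "q ^ M dvd C * q^(3*M)" for C :: 'a
    by (simp add: le_imp_power_dvd)
  have "q ^ M dvd P * (?R - 1)"
    by (rule dvd_mult[OF dvd_adm_gf_minus_1[OF d d]])
  with adm_gf_prod_mod[OF assms, of q A B M]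
  have "q ^ M dvd (adm_gf A B q N - P * ?R) + P * (?R - 1)"
    unfolding P_def by (rule dvd_add)
  then show ?thesis
    unfolding P by (simp add: algebra_simps)
qed

section \<open>Weights as monomials and extraction of coefficients\<close>

definition wt_u :: "(nat \<times> bool) list \<Rightarrow> nat" where
  "wt_u xs = length (filter (\<lambda>p. \<not> snd p \<and> (fst p mod 3 = 0 \<or> fst p mod 3 = 1)) xs)
    + 2 * length (filter (\<lambda>p. snd p \<and> fst p mod 6 = 5) xs)"

definition wt_v :: "(nat \<times> bool) list \<Rightarrow> nat" where
  "wt_v xs = length (filter (\<lambda>p. \<not> snd p \<and> (fst p mod 3 = 0 \<or> fst p mod 3 = 2)) xs)
    + 2 * length (filter (\<lambda>p. snd p \<and> fst p mod 6 = 1) xs)"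

lemma prod_list_part_weight:
  assumes "\<forall>p\<in>set xs. legal_part p"
  shows "prod_list (map (part_weight A B q) xs) =
    A ^ wt_u xs * B ^ wt_v xs * q ^ sum_list (map fst xs)"
  using assms
proof (induction xs)
  case Nil
  show ?case by (simp add: wt_u_def wt_v_def)
next
  case (Cons p xs)
  have three: "fst p mod 3 = 0 \<or> fst p mod 3 = 1 \<or> fst p mod 3 = 2" by presburger
  have over: "snd p \<Longrightarrow> fst p mod 6 = 1 \<or> fst p mod 6 = 5"
    using Cons.prems by (simp add: legal_part_def)
  define a b where "a = wt_u [p]" and "b = wt_v [p]"
  have "part_weight A B q p = A ^ a * B ^ b * q ^ fst p"
    using three over by (auto simp: a_def b_def part_weight_def wt_u_def wt_v_def)
  moreover have "wt_u (p # xs) = a + wt_u xs" "wt_v (p # xs) = b + wt_v xs"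
    by (simp_all add: wt_u_def wt_v_def a_def b_def)
  ultimately show ?case
    using Cons by (simp add: power_add mult_ac)
qed

lemma prod_residue_weight:
  assumes "finite S" "\<forall>x\<in>S. x mod 3 = 1 \<or> x mod 3 = (2::nat)"
  shows "(\<Prod>x\<in>S. (if x mod 3 = 1 then A else B) * q^x) =
    A ^ card {x\<in>S. x mod 3 = 1} * B ^ card {x\<in>S. x mod 3 = 2} * (q::'a::comm_ring_1) ^ \<Sum>S"
proof -
  have "S \<inter> - {x. x mod 3 = 1} = {x\<in>S. x mod 3 = 2}"
    using assms(2) by force
  moreover have "S \<inter> {x. x mod 3 = 1} = {x\<in>S. x mod 3 = 1}"
    by auto
  ultimately show ?thesis
    using assms(1) by (simp add: prod.distrib prod.If_cases power_sum)
qed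

text \<open>The variable \<open>q\<close> is the outermost one, so a congruence modulo
  \<open>var_q ^ M\<close> concerns the outer coefficients directly.\<close>

type_synonym poly3 = "int poly poly poly"

definition var_A :: poly3 where "var_A = [:[:monom 1 1:]:]"
definition var_B :: poly3 where "var_B = [:monom 1 1:]"
definition var_q :: poly3 where "var_q = monom 1 1"

lemma var_monom: "var_A ^ a * var_B ^ b * var_q ^ c = monom (monom (monom 1 a) b) c"
proof -
  have "var_A ^ a = monom (monom (monom 1 a) 0) 0" for a
    by (simp add: var_A_def monom_power flip: monom_0)
  moreover have "var_B ^ b = monom (monom 1 b) 0" for b
    by (simp add: var_B_def monom_power flip: monom_0)
  moreover have "var_q ^ c = monom 1 c" for c
    by (simp add: var_q_def monom_power)
  ultimately show ?thesis
    by (simp add: mult_monom)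
qed

lemma coeff_sum_var_monoms:
  assumes "finite T"
  shows "coeff (coeff (coeff (\<Sum>t\<in>T. var_A ^ f t * var_B ^ g t * var_q ^ h t) n) v) u =
    int (card {t\<in>T. f t = u \<and> g t = v \<and> h t = n})"
proof -
  have "coeff (coeff (coeff (var_A ^ f t * var_B ^ g t * var_q ^ h t) n) v) u =
      (if f t = u \<and> g t = v \<and> h t = n then 1 else 0)" for t
    by (simp add: var_monom)
  then show ?thesis
    using assms by (simp add: coeff_sum sum.If_cases Int_def)
qed

section \<open>The counted sets and the comparison of coefficients\<close>

text \<open>The positive gaps make the values strictly decreasing, which gives the order and the
  condition on overlines. A head of value at most \<open>n\<close> satisfies the bound since
  \<open>chi3\<close> adds at most 1 and \<open>n < N\<close>.\<close>

lemma D3_set_eq: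
  assumes "n < N"
  shows "D3_set u v n =
    {xs \<in> bounded_adm N. wt_u xs = u \<and> wt_v xs = v \<and> sum_list (map fst xs) = n}"
proof (intro set_eqI)
  fix xs
  let ?gaps = "\<forall>i. Suc i < length xs \<longrightarrow> fst (xs ! i) \<ge> fst (xs ! Suc i) + gap3 (xs ! i) (xs ! Suc i)"
  have adm: "admissible xs \<longleftrightarrow> (\<forall>p\<in>set xs. legal_part p) \<and> ?gaps"
    by (simp add: admissible_def successively_conv_nth)
  have dec: "fst (xs ! Suc i) < fst (xs ! i)" if ?gaps "Suc i < length xs" for i
  proof -
    have "gap3 (xs ! i) (xs ! Suc i) > 0" by (simp add: gap3_eq base_gap_def)
    with that show ?thesis by fastforce
  qed
  have overp: "is_overpartition xs n \<longleftrightarrow> (\<forall>p\<in>set xs. fst p > 0) \<and> sum_list (map fst xs) = n" if ?gaps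
  proof -
    have "successively (\<lambda>a b. fst b \<le> fst a) xs"
      using dec[OF that] by (auto simp: successively_conv_nth intro: less_imp_le)
    then have "sorted_wrt (\<lambda>a b. fst b \<le> fst a) xs"
      by (subst (asm) successively_iff_sorted_wrt_strong) (auto simp: transp_def)
    moreover have "i = 0 \<or> fst (xs ! (i - 1)) \<noteq> fst (xs ! i)" if "i < length xs" for i
      using dec[OF \<open>?gaps\<close>, of "i - 1"] that by (cases i) auto
    ultimately show ?thesis
      by (auto simp: is_overpartition_def)
  qed
  have head: "xs = [] \<or> fst (hd xs) + chi3 (hd xs) \<le> N" if "sum_list (map fst xs) = n"
  proof (cases xs)
    case (Cons p ys)
    then show ?thesis using that assms by (simp add: chi3_def)
  qed simp
  have legal: "(\<forall>p\<in>set xs. legal_part p) \<longleftrightarrow> (\<forall>p\<in>set xs. fst p > 0) \<and>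
      (\<forall>p\<in>set xs. snd p \<longrightarrow> fst p mod 6 = 1 \<or> fst p mod 6 = 5) \<and> (1, True) \<notin> set xs"
    unfolding legal_part_def by blast
  show "xs \<in> D3_set u v n \<longleftrightarrow>
    xs \<in> {xs \<in> bounded_adm N. wt_u xs = u \<and> wt_v xs = v \<and> sum_list (map fst xs) = n}"
    unfolding D3_set_def bounded_adm_def mem_Collect_eq adm legal wt_u_def[symmetric] wt_v_def[symmetric]
    using overp head by blast
qed

text \<open>Elements of a finite set with sum \<open>n\<close> are at most \<open>n\<close>, so the
  sets range over the subsets of a finite set.\<close>

lemma C3_set_eq:
  assumes "n < N"
  shows "{S :: nat set. finite S \<and> (\<forall>x\<in>S. x mod 3 = 1 \<or> x mod 3 = 2)
      \<and> card {x\<in>S. x mod 3 = 1} = u \<and> card {x\<in>S. x mod 3 = 2} = v \<and> \<Sum>S = n} =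
    {S \<in> Pow (nonmult3_below N). card {x\<in>S. x mod 3 = 1} = u \<and> card {x\<in>S. x mod 3 = 2} = v \<and> \<Sum>S = n}"
proof -
  have "finite S \<and> (\<forall>x\<in>S. x mod 3 = 1 \<or> x mod 3 = 2) \<longleftrightarrow> S \<subseteq> nonmult3_below N" if "\<Sum>S = n" for S
  proof -
    have "x < N" if "x \<in> S" "finite S" for x
      using member_le_sum[of x S id] that \<open>\<Sum>S = n\<close> assms by simp
    then show ?thesis
      using finite_subset[OF _ finite_nonmult3_below, of S N]
      by (auto simp: nonmult3_below_def)
  qed
  then show ?thesis by blast
qed

theorem theorem1p10:
  fixes u v n :: nat
  shows "C3 u v n = D3 u v n"
proof -
  \<comment> \<open>Modulo \<open>var_q ^ M\<close> with \<open>M = n + 1\<close> the coefficient of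
    index \<open>n\<close> is still determined; \<open>N\<close> only has to exceed
    \<open>M\<close>.\<close>
  define M N where "M = Suc n" and "N = Suc M"
  let ?X = "nonmult3_below (3 * M)"
  let ?c = "\<lambda>p :: poly3. coeff (coeff (coeff p n) v) u"
  have "adm_gf var_A var_B var_q N =
      (\<Sum>xs\<in>bounded_adm N. var_A ^ wt_u xs * var_B ^ wt_v xs * var_q ^ sum_list (map fst xs))"
    unfolding adm_gf_def
    by (intro sum.cong refl prod_list_part_weight) (simp add: bounded_adm_def admissible_def)
  then have D: "?c (adm_gf var_A var_B var_q N) = int (D3 u v n)"
    by (simp add: coeff_sum_var_monoms D3_def D3_set_eq[of n N] N_def M_def)
  \<comment> \<open>Expanding the product, each subset \<open>S\<close> records the factors from
    which the non-constant term is taken.\<close>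
  have "(\<Prod>x\<in>?X. 1 + (if x mod 3 = 1 then var_A else var_B) * var_q^x) =
      (\<Sum>S\<in>Pow ?X. \<Prod>x\<in>S. (if x mod 3 = 1 then var_A else var_B) * var_q^x)"
    by (subst add.commute, subst prod_add) simp_all
  also have "\<dots> = (\<Sum>S\<in>Pow ?X.
      var_A ^ card {x\<in>S. x mod 3 = 1} * var_B ^ card {x\<in>S. x mod 3 = 2} * var_q ^ \<Sum>S)"
  proof (intro sum.cong refl prod_residue_weight)
    fix S assume "S \<in> Pow ?X"
    then show "finite S" "\<forall>x\<in>S. x mod 3 = 1 \<or> x mod 3 = 2"
      using finite_subset[OF _ finite_nonmult3_below] by (auto simp: nonmult3_below_def)
  qed
  finally have C: "?c (\<Prod>x\<in>?X. 1 + (if x mod 3 = 1 then var_A else var_B) * var_q^x) = int (C3 u v n)"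
    by (simp only: coeff_sum_var_monoms finite_Pow_iff finite_nonmult3_below C3_def)
       (subst C3_set_eq[of n "3 * M"], simp_all only: M_def, simp)
  have "var_q ^ M dvd adm_gf var_A var_B var_q N -
      (\<Prod>x\<in>?X. 1 + (if x mod 3 = 1 then var_A else var_B) * var_q^x)"
    by (rule adm_gf_product) (simp add: N_def)
  moreover have "var_q ^ M = monom 1 M"
    by (simp add: var_q_def monom_power)
  \<comment> \<open>A multiple of \<open>monom 1 M\<close> has zero coefficients below
    \<open>M\<close>, in particular at \<open>n\<close>.\<close>
  ultimately have "coeff (adm_gf var_A var_B var_q N) n =
      coeff (\<Prod>x\<in>?X. 1 + (if x mod 3 = 1 then var_A else var_B) * var_q^x) n"
    unfolding M_def by (simp only: monom_1_dvd_iff' lessI coeff_diff right_minus_eq)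
  then show ?thesis
    using C D by simp
qed

end
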